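(* Let $n$ be an integer. Every meromorphic end of type $(2,2,n)$ is properly embedded.
   Context: Let $\mathbb{D}^*=\{z\in\mathbb{C}: 0<|z|<1\}$. A meromorphic end is a harmonic map $f:\mathbb{D}^*\to\mathbb{R}^3$ of the form $f(z)=\operatorname{Re}\int^z(\omega_1,\omega_2,\omega_3)$, where $\omega_1,\omega_2,\omega_3$ are 1-forms holomorphic on $\mathbb{D}^*$ and meromorphic at $0$; since $f$ is single valued, the residues of the $\omega_k$ at $0$ are real. The pole order of a form holomorphic at $0$ is $0$. Two ends $f,\tilde f$ are affinely equivalent if $\tilde f=A\circ f$ for an invertible real affine map $A:\mathbb{R}^3\to\mathbb{R}^3$. An end is in reduced form if the pole orders $n_k$ of $\omega_k$ at $0$ satisfy $n_1\le n_2\le n_3$ and $(n_1,n_2,n_3)$ is lexicographically minimal among all affinely equivalent ends. The type of an end is the tuple $(n_1,n_2,n_3)$ of an affinely equivalent end in reduced form. An end is properly embedded if $|f(z)|\to\infty$ as $z\to0$ and the restriction of $f$ to a sufficiently small punctured disk around $0$ is an injective immersion. *)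

theory Defs
  imports "HOL-Complex_Analysis.Complex_Analysis"
begin

definition punctured_disk :: "complex set" where
  "punctured_disk = ball 0 1 - {0}"

text \<open>
  A 1-form \<open>\<omega> = g dz\<close> on the punctured disk is represented by its coefficient function \<open>g\<close>.
  A triple of forms is a function on the index type \<^typ>\<open>3\<close>, with components
  \<open>1\<close>, \<open>2\<close>, \<open>3\<close> (where \<open>3 = 0\<close> in this type). Values outside the punctured disk are junk.
\<close>

definition meromorphic_forms :: "(3 \<Rightarrow> complex \<Rightarrow> complex) \<Rightarrow> bool" where
  "meromorphic_forms \<omega> \<longleftrightarrow>
     (\<forall>k. \<omega> k holomorphic_on punctured_disk \<and> \<omega> k meromorphic_on {0})"

text \<open>
  \<open>f z = Re (\<integral>\<^sup>z \<omega>)\<close>: the indefinite integral starts at some base point \<open>z0\<close> and carries the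
  additive constant \<open>f z0\<close>. As the formula is required along every path from \<open>z0\<close> to \<open>z\<close>,
  it includes that \<open>f\<close> is single valued, and hence that the residues of the forms are real.
  Harmonicity of \<open>f\<close> is a consequence as well.
\<close>

definition end_of_forms :: "(complex \<Rightarrow> real^3) \<Rightarrow> (3 \<Rightarrow> complex \<Rightarrow> complex) \<Rightarrow> bool" where
  "end_of_forms f \<omega> \<longleftrightarrow> meromorphic_forms \<omega> \<and>
     (\<exists>z0\<in>punctured_disk. \<forall>\<gamma>.
        valid_path \<gamma> \<and> path_image \<gamma> \<subseteq> punctured_disk \<and> pathstart \<gamma> = z0 \<longrightarrow>
        (\<forall>k. f (pathfinish \<gamma>) $ k = f z0 $ k + Re (contour_integral \<gamma> (\<omega> k))))"

definition meromorphic_end :: "(complex \<Rightarrow> real^3) \<Rightarrow> bool" where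
  "meromorphic_end f \<longleftrightarrow> (\<exists>\<omega>. end_of_forms f \<omega>)"

text \<open>
  The case distinction also covers forms vanishing near \<open>0\<close>, for which \<^const>\<open>zorder\<close> is
  unspecified; they are holomorphic at \<open>0\<close>.
\<close>

definition pole_order :: "(complex \<Rightarrow> complex) \<Rightarrow> int" where
  "pole_order g = (if is_pole g 0 then - zorder g 0 else 0)"

text \<open>
  Since \<open>f\<close> determines its forms on the punctured disk, this relation is functional in \<open>f\<close>.
\<close>

definition has_pole_orders :: "(complex \<Rightarrow> real^3) \<Rightarrow> int \<times> int \<times> int \<Rightarrow> bool" where
  "has_pole_orders f N \<longleftrightarrow>
     (\<exists>\<omega>. end_of_forms f \<omega> \<and> N = (pole_order (\<omega> 1), pole_order (\<omega> 2), pole_order (\<omega> 3)))"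

definition affinely_equivalent :: "(complex \<Rightarrow> real^3) \<Rightarrow> (complex \<Rightarrow> real^3) \<Rightarrow> bool" where
  "affinely_equivalent f h \<longleftrightarrow>
     (\<exists>(M :: real^3^3) b. invertible M \<and> (\<forall>z\<in>punctured_disk. h z = M *v f z + b))"

definition lex_less :: "((int \<times> int \<times> int) \<times> (int \<times> int \<times> int)) set" where
  "lex_less = {(x, y). x < y} <*lex*> {(x, y). x < y} <*lex*> {(x, y). x < y}"

definition in_reduced_form :: "(complex \<Rightarrow> real^3) \<Rightarrow> bool" where
  "in_reduced_form f \<longleftrightarrow>
     (\<exists>n1 n2 n3. has_pole_orders f (n1, n2, n3) \<and> n1 \<le> n2 \<and> n2 \<le> n3 \<and>
        (\<forall>h N. affinely_equivalent f h \<and> has_pole_orders h N \<longrightarrow> (N, (n1, n2, n3)) \<notin> lex_less))"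

definition has_end_type :: "(complex \<Rightarrow> real^3) \<Rightarrow> int \<times> int \<times> int \<Rightarrow> bool" where
  "has_end_type f N \<longleftrightarrow>
     (\<exists>h. affinely_equivalent f h \<and> in_reduced_form h \<and> has_pole_orders h N)"

definition immersion_on :: "(complex \<Rightarrow> real^3) \<Rightarrow> complex set \<Rightarrow> bool" where
  "immersion_on f U \<longleftrightarrow> (\<forall>z\<in>U. \<exists>D. (f has_derivative D) (at z) \<and> inj D)"

definition properly_embedded :: "(complex \<Rightarrow> real^3) \<Rightarrow> bool" where
  "properly_embedded f \<longleftrightarrow>
     filterlim (\<lambda>z. norm (f z)) at_top (at 0) \<and>
     (\<exists>r. 0 < r \<and> r < 1 \<and> inj_on f (ball 0 r - {0}) \<and> immersion_on f (ball 0 r - {0}))"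

end

theory Submission
  imports Defs "HOL-Real_Asymp.Real_Asymp"
begin

text \<open>
  Let \<open>c\<^sub>1\<close>, \<open>c\<^sub>2\<close> be the leading coefficients of the two forms with a double pole. If they were
  linearly dependent over the reals, a real combination of the two forms would have a pole of order
  at most 1, against lexicographic minimality. So \<open>u \<mapsto> (Re (c\<^sub>1 u), Re (c\<^sub>2 u))\<close> is injective on the
  plane, hence bounded below. As the residues are real, the first two components of the end are
  this map at \<open>u = - 1 / z\<close>, plus a multiple of \<open>ln \<bar>z\<bar>\<close> and a smooth term. Near 0 the main
  term dominates the others, for values, differences and differentials alike. The third
  component plays no role.
\<close>

section \<open>An end determines its forms and their pole orders\<close>

lemma open_punctured_disk: "open punctured_disk"
  by (simp add: punctured_disk_def open_delete)

lemma connected_punctured_disk: "connected punctured_disk"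
  by (simp add: punctured_disk_def connected_punctured_ball)

lemma punctured_disk_path:
  assumes "x \<in> punctured_disk" "y \<in> punctured_disk"
  obtains \<gamma> where "valid_path \<gamma>" "path_image \<gamma> \<subseteq> punctured_disk" "pathstart \<gamma> = x" "pathfinish \<gamma> = y"
  using connected_open_polynomial_connected[OF open_punctured_disk connected_punctured_disk assms]
    valid_path_polynomial_function by blast

lemma end_of_forms_holomorphic:
  "end_of_forms f \<omega> \<Longrightarrow> \<omega> k holomorphic_on punctured_disk"
  by (simp add: end_of_forms_def meromorphic_forms_def)

lemma end_of_forms_meromorphic:
  "end_of_forms f \<omega> \<Longrightarrow> \<omega> k meromorphic_on {0}"
  by (simp add: end_of_forms_def meromorphic_forms_def)

text \<open>\<open>end_of_forms\<close> only speaks of paths from one base point. Prepending a path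
  from there to the start of \<gamma> frees the starting point, so that short segments (for
  derivatives) and closed loops (for residues) become available.\<close>

lemma end_of_forms_increment:
  fixes f :: "complex \<Rightarrow> real^3"
  assumes f: "end_of_forms f \<omega>"
    and \<gamma>: "valid_path \<gamma>" "path_image \<gamma> \<subseteq> punctured_disk"
  shows "f (pathfinish \<gamma>) $ k = f (pathstart \<gamma>) $ k + Re (contour_integral \<gamma> (\<omega> k))"
proof -
  obtain z0 where z0: "z0 \<in> punctured_disk"
    and int: "\<And>\<gamma>. valid_path \<gamma> \<Longrightarrow> path_image \<gamma> \<subseteq> punctured_disk \<Longrightarrow> pathstart \<gamma> = z0 \<Longrightarrow>
        f (pathfinish \<gamma>) $ k = f z0 $ k + Re (contour_integral \<gamma> (\<omega> k))"
    using f unfolding end_of_forms_def by blast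
  have "pathstart \<gamma> \<in> punctured_disk"
    using \<gamma> by blast
  then obtain \<delta> where \<delta>: "valid_path \<delta>" "path_image \<delta> \<subseteq> punctured_disk"
    "pathstart \<delta> = z0" "pathfinish \<delta> = pathstart \<gamma>"
    using punctured_disk_path z0 by blast
  have integrable: "\<omega> k contour_integrable_on \<beta>"
    if "valid_path \<beta>" "path_image \<beta> \<subseteq> punctured_disk" for \<beta>
    using contour_integrable_holomorphic_simple[OF end_of_forms_holomorphic[OF f] open_punctured_disk] that
    by blast
  have "f (pathfinish (\<delta> +++ \<gamma>)) $ k = f z0 $ k + Re (contour_integral (\<delta> +++ \<gamma>) (\<omega> k))"
    using \<gamma> \<delta> by (intro int) (auto simp: path_image_join)
  also have "contour_integral (\<delta> +++ \<gamma>) (\<omega> k) = contour_integral \<delta> (\<omega> k) + contour_integral \<gamma> (\<omega> k)"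
    using \<gamma> \<delta> integrable by simp
  finally show ?thesis
    using int[OF \<delta>(1-3)] \<delta> by simp
qed

text \<open>On a small disk around z the form has a primitive F. Integrating along segments shows
  that the component is a constant plus Re F there.\<close>

lemma end_of_forms_component_derivative:
  fixes f :: "complex \<Rightarrow> real^3"
  assumes f: "end_of_forms f \<omega>" and z: "z \<in> punctured_disk"
  shows "((\<lambda>w. f w $ k) has_derivative (\<lambda>v. Re (\<omega> k z * v))) (at z)"
proof -
  obtain e where e: "e > 0" "ball z e \<subseteq> punctured_disk"
    using open_punctured_disk z openE by blast
  obtain F where F: "\<And>x. x \<in> ball z e \<Longrightarrow> (F has_field_derivative \<omega> k x) (at x within ball z e)"
    using holomorphic_convex_primitive'[of "ball z e" "\<omega> k"]
      holomorphic_on_subset[OF end_of_forms_holomorphic[OF f] e(2)] by auto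
  have eq: "f w $ k = f z $ k + Re (F w - F z)" if w: "w \<in> ball z e" for w
  proof -
    have seg: "path_image (linepath z w) \<subseteq> ball z e"
      using w e(1) by (simp add: closed_segment_subset)
    have "(\<omega> k has_contour_integral (F w - F z)) (linepath z w)"
      using contour_integral_primitive[OF F _ seg] by simp
    then show ?thesis
      using end_of_forms_increment[OF f, of "linepath z w" k] seg e(2)
      by (auto dest: contour_integral_unique)
  qed
  have "(F has_field_derivative \<omega> k z) (at z)"
    using F[of z] e(1) at_within_open[of z "ball z e"] by simp
  then have "((\<lambda>w. f z $ k + Re (F w - F z)) has_derivative (\<lambda>v. Re (\<omega> k z * v))) (at z)"
    unfolding has_field_derivative_def by (auto intro!: derivative_eq_intros)
  then show ?thesis
    by (rule has_derivative_transform_within_open[where s="ball z e", OF _ _ _ eq[symmetric]]) (use e(1) in auto)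
qed

lemma has_derivative_vec:
  fixes f :: "'a::euclidean_space \<Rightarrow> real^'n"
  assumes "\<And>k. ((\<lambda>x. f x $ k) has_derivative D k) (at x)"
  shows "(f has_derivative (\<lambda>v. \<chi> k. D k v)) (at x)"
  unfolding has_derivative_componentwise_within[of f]
  using assms by (auto simp: Basis_vec_def inner_axis)

lemma end_of_forms_derivative:
  assumes "end_of_forms f \<omega>" "z \<in> punctured_disk"
  shows "(f has_derivative (\<lambda>v. \<chi> k. Re (\<omega> k z * v))) (at z)"
  by (intro has_derivative_vec end_of_forms_component_derivative assms)

text \<open>Both forms give the same differential of \<open>f\<close>, and the real-linear map v
  \<mapsto> Re (a * v) determines a through its values at 1 and \<open>\<i>\<close>.\<close>

lemma end_of_forms_unique:
  assumes "end_of_forms f \<omega>" "end_of_forms f \<omega>'" "z \<in> punctured_disk"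
  shows "\<omega> k z = \<omega>' k z"
proof -
  have eq: "Re (\<omega> k z * v) = Re (\<omega>' k z * v)" for v
    using has_derivative_unique[OF end_of_forms_component_derivative[OF assms(1,3)]
        end_of_forms_component_derivative[OF assms(2,3)], of k] by meson
  show ?thesis
    using eq[of 1] eq[of \<i>] by (simp add: complex_eq_iff)
qed

lemma eventually_punctured_disk: "eventually (\<lambda>z. z \<in> punctured_disk) (at 0)"
  unfolding punctured_disk_def eventually_at by (auto intro!: exI[of _ 1])

text \<open>Two families of forms for \<open>f\<close> agree on the punctured disk, and
  \<open>pole_order\<close> sees only the values near 0. In the final theorem this identifies the
  minimal triple hidden in \<open>in_reduced_form\<close> with the triple of the type.\<close>

lemma has_pole_orders_unique:
  assumes "has_pole_orders f N" "has_pole_orders f N'"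
  shows "N = N'"
proof -
  obtain \<omega> \<omega>' where \<omega>: "end_of_forms f \<omega>" "end_of_forms f \<omega>'"
    and N: "N = (pole_order (\<omega> 1), pole_order (\<omega> 2), pole_order (\<omega> 3))"
      "N' = (pole_order (\<omega>' 1), pole_order (\<omega>' 2), pole_order (\<omega>' 3))"
    using assms unfolding has_pole_orders_def by blast
  have "eventually (\<lambda>z. \<omega> k z = \<omega>' k z) (at 0)" for k
    using eventually_punctured_disk by eventually_elim (rule end_of_forms_unique[OF \<omega>])
  then have "pole_order (\<omega> k) = pole_order (\<omega>' k)" for k
    unfolding pole_order_def using zorder_cong is_pole_cong by metis
  then show ?thesis
    by (simp add: N)
qed

section \<open>Laurent expansions at the puncture\<close>

lemma pole_factorization:
  assumes g: "g holomorphic_on punctured_disk" "is_pole g 0"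
  obtains r P where "0 < r" "r < 1" "P holomorphic_on ball 0 r" "P 0 \<noteq> 0"
    "\<And>z. z \<in> ball 0 r - {0} \<Longrightarrow> g z = P z / z ^ nat (pole_order g)"
proof -
  have "g holomorphic_on ball 0 1 - {0}"
    using g(1) by (simp add: punctured_disk_def)
  note * = zorder_exist_pole[OF this open_ball _ g(2)]
  have c: "zor_poly g 0 0 \<noteq> 0"
    using * by simp
  obtain r where r: "r > 0" "cball 0 r \<subseteq> ball (0::complex) 1" and hol: "zor_poly g 0 holomorphic_on cball 0 r"
    and eq: "\<forall>w\<in>cball 0 r - {0}. g w = zor_poly g 0 w / (w - 0) ^ nat (- zorder g 0) \<and> zor_poly g 0 w \<noteq> 0"
    using * by force
  \<comment> \<open>The real point r lies in the closed disk of radius r, hence in the open unit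
    disk.\<close>
  have "r < 1"
    using subsetD[OF r(2), of "of_real r"] r(1) by simp
  moreover have "zor_poly g 0 holomorphic_on ball 0 r"
    using hol by (rule holomorphic_on_subset) auto
  moreover have "g z = zor_poly g 0 z / z ^ nat (pole_order g)" if "z \<in> ball 0 r - {0}" for z
    using bspec[OF eq, of z] that g(2) by (simp add: pole_order_def)
  ultimately show ?thesis
    using that r(1) c by blast
qed

lemma double_pole_expansion:
  assumes g: "g holomorphic_on punctured_disk" and "pole_order g = 2"
  obtains c a r q where "c \<noteq> 0" "0 < r" "r < 1" "q holomorphic_on ball 0 r"
    "\<And>z. z \<in> ball 0 r - {0} \<Longrightarrow> g z = c / z^2 + a / z + q z"
proof -
  have "is_pole g 0"
    using assms(2) unfolding pole_order_def by (auto split: if_splits)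
  then obtain r P where r: "0 < r" "r < 1" and P: "P holomorphic_on ball 0 r" "P 0 \<noteq> 0"
    and gP: "\<And>z. z \<in> ball 0 r - {0} \<Longrightarrow> g z = P z / z ^ nat (pole_order g)"
    using pole_factorization[OF g] by metis
  \<comment> \<open>Two difference quotients at 0 peel off the first two Taylor coefficients of P.
    With the derivative as value at 0, each quotient is holomorphic on the whole disk.\<close>
  define P1 where "P1 = (\<lambda>z. if z = 0 then deriv P 0 else (P z - P 0) / (z - 0))"
  define q where "q = (\<lambda>z. if z = 0 then deriv P1 0 else (P1 z - P1 0) / (z - 0))"
  have "P1 holomorphic_on ball 0 r"
    unfolding P1_def by (rule pole_lemma[OF P(1)]) (use r in auto)
  then have q: "q holomorphic_on ball 0 r"
    unfolding q_def by (rule pole_lemma) (use r in auto)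
  have "g z = P 0 / z^2 + P1 0 / z + q z" if "z \<in> ball 0 r - {0}" for z
  proof -
    have "z \<noteq> 0" "g z = P z / z^2"
      using that gP[of z] assms(2) by auto
    moreover have "q z = ((P z - P 0) / z - P1 0) / z"
      using \<open>z \<noteq> 0\<close> by (simp add: q_def P1_def)
    ultimately show ?thesis
      by (simp add: field_simps power2_eq_square)
  qed
  then show ?thesis
    using that[of "P 0" r q "P1 0"] q r P(2) by blast
qed

text \<open>For a pole of order m \<ge> 2, the function z^m * g z has a nonzero limit at 0. But it
  is also z^(m-2) times z^2 * g z, and so tends to 0.\<close>

lemma pole_order_less_2:
  assumes g: "g holomorphic_on punctured_disk"
    and lim: "((\<lambda>z. z^2 * g z) \<longlongrightarrow> 0) (at 0)"
  shows "pole_order g < 2"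
proof (rule ccontr)
  assume ge: "\<not> pole_order g < 2"
  then have "is_pole g 0"
    unfolding pole_order_def by (auto split: if_splits)
  then obtain r P where r: "0 < r" and P: "P holomorphic_on ball 0 r" "P 0 \<noteq> 0"
    and gP: "\<And>z. z \<in> ball 0 r - {0} \<Longrightarrow> g z = P z / z ^ nat (pole_order g)"
    using pole_factorization[OF g] by metis
  define m where "m = nat (pole_order g)"
  have m: "m \<ge> 2"
    using ge by (simp add: m_def)
  have "((\<lambda>z. z^(m - 2) * (z^2 * g z)) \<longlongrightarrow> 0 ^ (m - 2) * 0) (at 0)"
    by (intro tendsto_intros lim)
  moreover have "eventually (\<lambda>z. z^(m - 2) * (z^2 * g z) = P z) (at 0)"
    unfolding eventually_at
  proof (intro exI conjI ballI impI)
    fix z :: complex assume z: "z \<noteq> 0 \<and> dist z 0 < r"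
    have "z^(m - 2) * (z^2 * g z) = z^m * g z"
      using m by (metis le_add_diff_inverse2 mult.assoc power_add)
    also have "\<dots> = P z"
      using gP[of z] z by (simp add: m_def)
    finally show "z^(m - 2) * (z^2 * g z) = P z" .
  qed (use r in auto)
  ultimately have "(P \<longlongrightarrow> 0) (at 0)"
    by (simp add: tendsto_cong)
  moreover have "P \<midarrow>0\<rightarrow> P 0"
    using holomorphic_on_imp_continuous_on[OF P(1)] r
    by (simp add: continuous_on_eq_continuous_at isCont_def)
  ultimately show False
    using P(2) LIM_unique by blast
qed

text \<open>Around a circle the terms c / z^2 and q integrate to 0, since they have primitives, so
  the integral of the form is 2 \<pi> i a. Its real part is the increment of \<open>f\<close> along
  a closed loop, which vanishes.\<close>

lemma real_residue:
  assumes f: "end_of_forms f \<omega>" and r: "0 < r" "r < 1"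
    and q: "q holomorphic_on ball 0 r"
    and \<omega>: "\<And>z. z \<in> ball 0 r - {0} \<Longrightarrow> \<omega> k z = c / z^2 + a / z + q z"
  shows "Im a = 0"
proof -
  define \<gamma> where "\<gamma> = circlepath (0::complex) (r/2)"
  have im: "path_image \<gamma> \<subseteq> ball 0 r - {0}" "valid_path \<gamma>" "pathstart \<gamma> = pathfinish \<gamma>"
    using r by (auto simp: \<gamma>_def)
  obtain Q where Q: "\<And>x. x \<in> ball 0 r \<Longrightarrow> (Q has_field_derivative q x) (at x)"
    using holomorphic_convex_primitive'[of "ball 0 r" q] q
    by (metis at_within_open convex_ball open_ball)
  have "((\<lambda>z. - c / z + Q z) has_field_derivative c / z^2 + q z) (at z within ball 0 r - {0})"
    if "z \<in> ball 0 r - {0}" for z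
    using that by (auto intro!: derivative_eq_intros DERIV_subset[OF Q] simp: field_simps power2_eq_square)
  from contour_integral_primitive[OF this im(2,1)]
  have "((\<lambda>z. c / z^2 + q z) has_contour_integral 0) \<gamma>"
    by (simp add: im(3))
  moreover have "((\<lambda>z. a * (1 / (z - 0))) has_contour_integral a * (2 * of_real pi * \<i>)) \<gamma>"
    unfolding \<gamma>_def
  proof (rule has_contour_integral_lmul)
    have "(\<lambda>z. 1 / (z - 0)) contour_integrable_on circlepath 0 (r/2)"
      using r by (intro contour_integrable_holomorphic_simple[of _ "- {0}"] holomorphic_intros) auto
    then show "((\<lambda>z. 1 / (z - 0)) has_contour_integral 2 * of_real pi * \<i>) (circlepath 0 (r/2))"
      using contour_integral_circlepath[of "r/2" 0] r has_contour_integral_integral by fastforce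
  qed
  ultimately have "((\<lambda>z. (c / z^2 + q z) + a * (1 / (z - 0))) has_contour_integral
      a * (2 * of_real pi * \<i>)) \<gamma>"
    using has_contour_integral_add by fastforce
  then have "(\<omega> k has_contour_integral a * (2 * of_real pi * \<i>)) \<gamma>"
    by (rule has_contour_integral_eq) (use \<omega> subsetD[OF im(1)] in \<open>simp add: add_ac\<close>)
  then have "contour_integral \<gamma> (\<omega> k) = a * (2 * of_real pi * \<i>)"
    by (rule contour_integral_unique)
  moreover have "Re (contour_integral \<gamma> (\<omega> k)) = 0"
  proof -
    have "path_image \<gamma> \<subseteq> punctured_disk"
      using im(1) r by (force simp: punctured_disk_def)
    then show ?thesis
      using end_of_forms_increment[OF f im(2), of k] im(3) by simp
  qed
  ultimately show ?thesis
    by simp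
qed

text \<open>Integrates the Laurent expansion term by term. Since the residue is real, the term
  \<rho> / z contributes the single-valued function \<rho> ln |z|. The two sides then have the same
  differential on a connected set and differ by a constant.\<close>

lemma component_expansion:
  fixes f :: "complex \<Rightarrow> real^3"
  assumes f: "end_of_forms f \<omega>" and "pole_order (\<omega> k) = 2"
  obtains c \<rho> r Q q L where "c \<noteq> 0" "0 < r" "r < 1" "0 \<le> L"
    "\<And>z. z \<in> ball 0 r \<Longrightarrow> (Q has_field_derivative q z) (at z)"
    "\<And>z. z \<in> ball 0 r \<Longrightarrow> norm (q z) \<le> L"
    "\<And>z. z \<in> ball 0 r - {0} \<Longrightarrow> \<omega> k z = c / z^2 + of_real \<rho> / z + q z"
    "\<And>z. z \<in> ball 0 r - {0} \<Longrightarrow> f z $ k = Re (- c / z) + \<rho> * ln (norm z) + Re (Q z)"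
proof -
  obtain c a r q where c: "c \<noteq> 0" and r: "0 < r" "r < 1" and q: "q holomorphic_on ball 0 r"
    and \<omega>: "\<And>z. z \<in> ball 0 r - {0} \<Longrightarrow> \<omega> k z = c / z^2 + a / z + q z"
    using double_pole_expansion[OF end_of_forms_holomorphic[OF f] assms(2)] by metis
  define \<rho> where "\<rho> = Re a"
  have a: "a = of_real \<rho>"
    using real_residue[OF f r q \<omega>] by (simp add: \<rho>_def complex_eq_iff)
  obtain Q where Q: "\<And>x. x \<in> ball 0 r \<Longrightarrow> (Q has_field_derivative q x) (at x)"
    using holomorphic_convex_primitive'[of "ball 0 r" q] q
    by (metis at_within_open convex_ball open_ball)
  define B where "B = ball (0::complex) r - {0}"
  define d where "d = (\<lambda>z. f z $ k - (Re (- c / z) + \<rho> * ln (norm z) + Re (Q z)))"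
  have B: "B \<subseteq> punctured_disk" "open B" "connected B"
    using r by (auto simp: B_def punctured_disk_def open_delete connected_punctured_ball)
  have d: "(d has_derivative (\<lambda>_. 0)) (at z)" if z: "z \<in> B" for z
  proof -
    have z0: "z \<noteq> 0"
      using z by (auto simp: B_def)
    have "((\<lambda>z. - c / z + Q z) has_field_derivative c / z^2 + q z) (at z)"
      using z by (auto intro!: derivative_eq_intros Q simp: B_def field_simps power2_eq_square)
    then have 1: "((\<lambda>z. Re (- c / z + Q z)) has_derivative (\<lambda>v. Re ((c / z^2 + q z) * v))) (at z)"
      unfolding has_field_derivative_def by (rule has_derivative_Re)
    have 2: "((\<lambda>z. \<rho> * ln (norm z)) has_derivative (\<lambda>v. \<rho> * (inner v (sgn z) / norm z))) (at z)"
      using has_derivative_mult_right[OF has_derivative_ln[OF _ has_derivative_norm[OF z0]], of \<rho>] z0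
      by (simp add: divide_inverse)
    \<comment> \<open>The differential of ln |z| is the real part of the form dz / z.\<close>
    have 3: "inner v (sgn z) / norm z = Re (v / z)" for v
    proof -
      have "sgn z = z / norm z"
        by (simp add: sgn_eq)
      then have "inner v (sgn z) / norm z = (Re v * Re z + Im v * Im z) / (norm z)^2"
        by (simp add: inner_complex_def add_divide_distrib power2_eq_square)
      then show ?thesis
        by (simp add: Re_divide cmod_power2)
    qed
    have "d = (\<lambda>z. f z $ k - (Re (- c / z + Q z) + \<rho> * ln (norm z)))"
      by (auto simp: d_def)
    then have "(d has_derivative (\<lambda>v. Re (\<omega> k z * v) - (Re ((c / z^2 + q z) * v) + \<rho> * Re (v / z)))) (at z)"
      using has_derivative_diff[OF end_of_forms_component_derivative[OF f, of z k]
          has_derivative_add[OF 1 2]] subsetD[OF B(1) z]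
      by (simp only: 3)
    moreover have "Re (\<omega> k z * v) - (Re ((c / z^2 + q z) * v) + \<rho> * Re (v / z)) = 0" for v
    proof -
      have eq: "\<omega> k z * v = (c / z^2 + q z) * v + of_real \<rho> * (v / z)"
        using \<omega>[of z] z by (simp add: B_def a algebra_simps)
      show ?thesis
        unfolding eq by (simp del: times_divide_eq_right)
    qed
    ultimately show ?thesis
      by simp
  qed
  have "continuous_on B d"
    using B(2) by (auto simp: continuous_on_eq_continuous_at intro: has_derivative_continuous[OF d])
  then have "d constant_on B"
    using d by (intro has_derivative_zero_connected_constant_on[of _ "{}"] B)
      (auto intro: has_derivative_at_withinI)
  then obtain C where C: "\<And>z. z \<in> B \<Longrightarrow> d z = C"
    unfolding constant_on_def by blast
  \<comment> \<open>The bound on q comes from compactness of a smaller closed disk, hence the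
    passage to radius r/2.\<close>
  have "compact (q ` cball 0 (r/2))"
    using r q by (intro compact_continuous_image continuous_on_subset[OF holomorphic_on_imp_continuous_on[OF q]]) auto
  then obtain L where L: "\<And>z. z \<in> cball 0 (r/2) \<Longrightarrow> norm (q z) \<le> L"
    using compact_imp_bounded bounded_iff by (metis imageI)
  have "norm (q 0) \<le> L"
    using L[of 0] r by simp
  then have "0 \<le> L"
    using norm_ge_zero order_trans by blast
  show ?thesis
  \<comment> \<open>The constant of integration is absorbed into Q, which leaves its derivative q
    unchanged.\<close>
  proof (rule that[of c "r/2" L "\<lambda>z. Q z + of_real C" q \<rho>])
    fix z :: complex
    assume "z \<in> ball 0 (r/2) - {0}"
    then have z: "z \<in> B"
      using r by (auto simp: B_def)
    show "\<omega> k z = c / z^2 + of_real \<rho> / z + q z"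
      using \<omega>[of z] z by (simp add: a B_def)
    show "f z $ k = Re (- c / z) + \<rho> * ln (norm z) + Re (Q z + of_real C)"
      using C[OF z] by (simp add: d_def)
  next
    fix z :: complex assume "z \<in> ball 0 (r/2)"
    then show "((\<lambda>z. Q z + of_real C) has_field_derivative q z) (at z)"
      using r by (auto intro!: derivative_eq_intros Q)
  qed (use c r L \<open>0 \<le> L\<close> in auto)
qed

section \<open>Dominance of the double poles near the puncture\<close>

lemma filterlim_norm_at_right_0: "filterlim (norm :: 'a::real_normed_vector \<Rightarrow> real) (at_right 0) (at 0)"
  unfolding filterlim_at
  by (auto simp: tendsto_norm_zero_iff eventually_at intro!: exI[of _ 1])

text \<open>This is the shape, with x = |z|, of the lower bound for the norm of an end: 1/x outgrows
  the logarithm.\<close>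

lemma log_perturbation_at_top:
  fixes m K C :: real
  assumes "m > 0"
  shows "filterlim (\<lambda>x. (m / x + K * ln x - C) / 2) at_top (at_right 0)"
  using assms by real_asymp

text \<open>The one-parameter family in \<open>indep\<close> captures real independence of the
  leading coefficients: the second one is nonzero, so dependence would make the first a real
  multiple of it.\<close>

lemma double_pole_end_properly_embedded:
  fixes f :: "complex \<Rightarrow> real^3"
  assumes f: "end_of_forms f \<omega>"
    and po1: "pole_order (\<omega> 1) = 2" and po2: "pole_order (\<omega> 2) = 2"
    and indep: "\<And>t::real. pole_order (\<lambda>z. \<omega> 1 z - of_real t * \<omega> 2 z) \<ge> 2"
  shows "properly_embedded f"
proof -
  obtain c1 \<rho>1 r1 Q1 q1 L1 where 1: "c1 \<noteq> 0" "0 < r1" "r1 < 1" "0 \<le> L1"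
    "\<And>z. z \<in> ball 0 r1 \<Longrightarrow> (Q1 has_field_derivative q1 z) (at z)"
    "\<And>z. z \<in> ball 0 r1 \<Longrightarrow> norm (q1 z) \<le> L1"
    "\<And>z. z \<in> ball 0 r1 - {0} \<Longrightarrow> \<omega> 1 z = c1 / z^2 + of_real \<rho>1 / z + q1 z"
    "\<And>z. z \<in> ball 0 r1 - {0} \<Longrightarrow> f z $ 1 = Re (- c1 / z) + \<rho>1 * ln (norm z) + Re (Q1 z)"
    by (rule component_expansion[OF f po1]) blast
  obtain c2 \<rho>2 r2 Q2 q2 L2 where 2: "c2 \<noteq> 0" "0 < r2" "r2 < 1" "0 \<le> L2"
    "\<And>z. z \<in> ball 0 r2 \<Longrightarrow> (Q2 has_field_derivative q2 z) (at z)"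
    "\<And>z. z \<in> ball 0 r2 \<Longrightarrow> norm (q2 z) \<le> L2"
    "\<And>z. z \<in> ball 0 r2 - {0} \<Longrightarrow> \<omega> 2 z = c2 / z^2 + of_real \<rho>2 / z + q2 z"
    "\<And>z. z \<in> ball 0 r2 - {0} \<Longrightarrow> f z $ 2 = Re (- c2 / z) + \<rho>2 * ln (norm z) + Re (Q2 z)"
    by (rule component_expansion[OF f po2]) blast
  define r0 where "r0 = min r1 r2"
  have r0: "0 < r0" "r0 < 1" "\<And>z. z \<in> ball 0 r0 - {0} \<Longrightarrow> z \<in> ball (0::complex) r1 - {0} \<and> z \<in> ball 0 r2 - {0}"
    "\<And>z. z \<in> ball 0 r0 \<Longrightarrow> z \<in> ball (0::complex) r1 \<and> z \<in> ball 0 r2"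
    using 1(2,3) 2(2,3) by (auto simp: r0_def)
  \<comment> \<open>If c1 = t * c2, the double poles of the combination cancel, so z^2 times it is
    O(|z|), contrary to \<open>indep\<close>.\<close>
  have c_indep: "c1 \<noteq> of_real t * c2" for t :: real
  proof
    assume c1: "c1 = of_real t * c2"
    let ?g = "\<lambda>z. \<omega> 1 z - of_real t * \<omega> 2 z"
    let ?B = "\<lambda>z::complex. norm (of_real \<rho>1 - of_real t * of_real \<rho>2 :: complex) * norm z + (L1 + \<bar>t\<bar> * L2) * (norm z)^2"
    have "?g holomorphic_on punctured_disk"
      by (intro holomorphic_intros end_of_forms_holomorphic[OF f])
    moreover have "((\<lambda>z. z^2 * ?g z) \<longlongrightarrow> 0) (at 0)"
    proof (rule Lim_null_comparison)
      show "eventually (\<lambda>z. norm (z^2 * ?g z) \<le> ?B z) (at 0)"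
        unfolding eventually_at
      proof (intro exI conjI ballI impI)
        fix z :: complex assume "z \<noteq> 0 \<and> dist z 0 < r0"
        then have z: "z \<noteq> 0" "z \<in> ball 0 r0 - {0}" "z \<in> ball 0 r0"
          by auto
        note z' = r0(3)[OF z(2)] r0(4)[OF z(3)]
        have "z^2 * ?g z = (of_real \<rho>1 - of_real t * of_real \<rho>2) * z + (q1 z - of_real t * q2 z) * z^2"
          using z' z(1) by (simp add: 1(7) 2(7) c1 field_simps power2_eq_square)
        also have "norm \<dots> \<le> norm (of_real \<rho>1 - of_real t * of_real \<rho>2 :: complex) * norm z
            + norm (q1 z - of_real t * q2 z) * (norm z)^2"
          by (rule order_trans[OF norm_triangle_ineq]) (simp add: norm_mult norm_power)
        also have "norm (q1 z - of_real t * q2 z) \<le> L1 + \<bar>t\<bar> * L2"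
        proof -
          have "norm (q1 z - of_real t * q2 z) \<le> norm (q1 z) + \<bar>t\<bar> * norm (q2 z)"
            using norm_triangle_ineq4[of "q1 z" "of_real t * q2 z"] by (simp add: norm_mult)
          also have "\<dots> \<le> L1 + \<bar>t\<bar> * L2"
            using z' by (intro add_mono mult_left_mono 1(6) 2(6)) auto
          finally show ?thesis .
        qed
        finally show "norm (z^2 * ?g z) \<le> ?B z"
          by (simp add: mult_right_mono)
      qed (use r0 in auto)
      show "(?B \<longlongrightarrow> 0) (at 0)"
        by (auto intro!: tendsto_eq_intros)
    qed
    ultimately have "pole_order ?g < 2"
      by (rule pole_order_less_2)
    then show False
      using indep[of t] by simp
  qed
  obtain m where m: "m > 0" "\<And>u. m * norm u \<le> \<bar>Re (c1 * u)\<bar> + \<bar>Re (c2 * u)\<bar>"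
  proof -
    let ?F = "\<lambda>u. (Re (c1 * u), Re (c2 * u))"
    have lin: "linear ?F"
      by (rule linearI) (simp_all add: algebra_simps)
    have "u = 0" if u: "?F u = 0" for u
    proof (rule ccontr)
      assume "u \<noteq> 0"
      \<comment> \<open>For u in the kernel both products are purely imaginary, so their quotient t
        is real. Cancelling u gives the excluded relation c1 = t * c2.\<close>
      define t where "t = Im (c1 * u) / Im (c2 * u)"
      have re: "Re (c1 * u) = 0" "Re (c2 * u) = 0"
        using u by (simp_all add: zero_prod_def)
      moreover have "c2 * u \<noteq> 0"
        using \<open>u \<noteq> 0\<close> 2(1) by simp
      ultimately have "Im (c2 * u) \<noteq> 0"
        by (metis complex_eq_iff zero_complex.sel)
      moreover have "a = of_real (Im a / Im b) * b" if "Re a = 0" "Re b = 0" "Im b \<noteq> 0" for a b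
        by (simp add: complex_eq_iff that)
      ultimately have "c1 * u = of_real t * (c2 * u)"
        using re unfolding t_def by blast
      then show False
        using c_indep[of t] \<open>u \<noteq> 0\<close> by simp
    qed
    then have "inj ?F"
      using linear_injective_0[OF lin] by blast
    then obtain m where "m > 0" "\<And>u. m * norm u \<le> norm (?F u)"
      using linear_inj_bounded_below_pos[OF lin] by blast
    moreover have "norm (?F u) \<le> \<bar>Re (c1 * u)\<bar> + \<bar>Re (c2 * u)\<bar>" for u
      using norm_Pair_le[of "Re (c1 * u)" "Re (c2 * u)"] by simp
    ultimately show ?thesis
      using that order_trans by blast
  qed
  define K where "K = \<bar>\<rho>1\<bar> + \<bar>\<rho>2\<bar>"
  define L where "L = L1 + L2"
  have KL: "0 \<le> K" "0 \<le> L"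
    using 1(4) 2(4) by (auto simp: K_def L_def)
  \<comment> \<open>Chosen so that (K + L) * |z| < m, the inequality behind both injectivity and
    immersion. The summand 1 covers K + L = 0, where m / 0 = 0 would leave an empty disk.\<close>
  define r where "r = min r0 (m / (K + L + 1))"
  have r: "0 < r" "r < 1"
    using r0 m(1) KL by (auto simp: r_def)
  have small: "(K + L) * norm z < m" if "z \<in> ball 0 r" for z :: complex
  proof -
    have "norm z * (K + L + 1) < m"
      using that KL by (simp add: r_def pos_less_divide_eq)
    then show ?thesis
      using norm_ge_zero[of z] unfolding distrib_left distrib_right mult.commute[of "norm z"] by linarith
  qed

  have immersion: "immersion_on f (ball 0 r - {0})"
    unfolding immersion_on_def
  proof
    fix z :: complex assume "z \<in> ball 0 r - {0}"
    then have z: "z \<noteq> 0" "z \<in> ball 0 r" "z \<in> ball 0 r0" "z \<in> ball 0 r0 - {0}" "norm z < 1"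
      using r by (auto simp: r_def)
    note z' = r0(3)[OF z(4)] r0(4)[OF z(3)]
    let ?D = "\<lambda>v. \<chi> k. Re (\<omega> k z * v)"
    have D: "(f has_derivative ?D) (at z)"
      using z by (intro end_of_forms_derivative f) (auto simp: punctured_disk_def)
    have "v = 0" if v: "?D v = 0" for v
    proof -
      \<comment> \<open>This turns the leading term of the differential into c * u; the remaining
        terms are (\<rho> + q * z) * (z * u), smaller by a factor |z|.\<close>
      define u where "u = v / z^2"
      have bound: "\<bar>Re (c * u)\<bar> \<le> (\<bar>\<rho>\<bar> + l) * (norm z * norm u)"
        if "\<omega> k z = c / z^2 + of_real \<rho> / z + q" "norm q \<le> l" for k c \<rho> q l
      proof -
        have "Re (\<omega> k z * v) = 0"
          using v by (simp add: vec_eq_iff)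
        moreover have "\<omega> k z * v = c * u + (of_real \<rho> + q * z) * (z * u)"
          using z(1) by (simp add: that(1) u_def field_simps power2_eq_square)
        ultimately have "\<bar>Re (c * u)\<bar> = \<bar>Re ((of_real \<rho> + q * z) * (z * u))\<bar>"
          by (simp only: plus_complex.sel)
        also have "\<dots> \<le> norm (of_real \<rho> + q * z) * (norm z * norm u)"
          using abs_Re_le_cmod[of "(of_real \<rho> + q * z) * (z * u)"] by (simp only: norm_mult)
        also have "\<dots> \<le> (\<bar>\<rho>\<bar> + l) * (norm z * norm u)"
        proof (rule mult_right_mono)
          have "norm (of_real \<rho> + q * z) \<le> \<bar>\<rho>\<bar> + norm q * norm z"
            by (rule order_trans[OF norm_triangle_ineq]) (simp add: norm_mult)
          also have "norm q * norm z \<le> l * 1"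
            using that(2) z(5) order_trans[OF norm_ge_zero that(2)] by (intro mult_mono) auto
          finally show "norm (of_real \<rho> + q * z) \<le> \<bar>\<rho>\<bar> + l"
            by simp
        qed simp
        finally show ?thesis .
      qed
      have "m * norm u \<le> \<bar>Re (c1 * u)\<bar> + \<bar>Re (c2 * u)\<bar>"
        by (rule m)
      also have "\<dots> \<le> (\<bar>\<rho>1\<bar> + L1) * (norm z * norm u) + (\<bar>\<rho>2\<bar> + L2) * (norm z * norm u)"
        using z' by (intro add_mono bound[OF 1(7,6)] bound[OF 2(7,6)]) auto
      also have "\<dots> = (K + L) * norm z * norm u"
        by (simp add: K_def L_def algebra_simps)
      \<comment> \<open>The error is absorbed into the main term; by \<open>small\<close> the first
        factor is positive, which forces u = 0.\<close>
      finally have "(m - (K + L) * norm z) * norm u \<le> 0"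
        by (simp add: algebra_simps)
      then have "norm u \<le> 0"
        using small[OF z(2)] by (simp add: mult_le_0_iff)
      then show "v = 0"
        using z(1) by (simp add: u_def)
    qed
    then have "inj ?D"
      using linear_injective_0[OF has_derivative_linear[OF D]] by blast
    then show "\<exists>D. (f has_derivative D) (at z) \<and> inj D"
      using D by blast
  qed

  have no_double: "f z \<noteq> f w"
    if "z \<noteq> w" "norm z \<le> norm w" "z \<in> ball 0 r - {0}" "w \<in> ball 0 r - {0}" for z w
  proof
    assume eq: "f z = f w"
    \<comment> \<open>Up to sign, c * u is the difference of the leading terms at z and w. If
      \<open>f z = f w\<close>, the logarithmic and smooth terms must cancel its real part.\<close>
    define u where "u = 1 / z - 1 / w"
    have z: "z \<noteq> 0" "z \<in> ball 0 r0" "z \<in> ball 0 r0 - {0}" and w: "w \<noteq> 0" "w \<in> ball 0 r0" "w \<in> ball 0 r0 - {0}"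
      using that by (auto simp: r_def)
    note z' = r0(3)[OF z(3)] r0(4)[OF z(2)] and w' = r0(3)[OF w(3)] r0(4)[OF w(2)]
    \<comment> \<open>From ln x \<le> x - 1 at x = |w| / |z|; the assumption |z| \<le> |w| makes
      this one-sided estimate suffice.\<close>
    have ln: "\<bar>ln (norm z) - ln (norm w)\<bar> \<le> norm (z - w) / norm z"
    proof -
      have "ln (norm w) - ln (norm z) \<le> (norm w - norm z) / norm z"
        using ln_diff_le[of "norm w" "norm z"] z w by simp
      also have "\<dots> \<le> norm (z - w) / norm z"
        using norm_triangle_ineq2[of w z] by (intro divide_right_mono) (auto simp: norm_minus_commute)
      finally show ?thesis
        using that(2) z w by (simp add: abs_if)
    qed
    have bound: "\<bar>Re (c * u)\<bar> \<le> \<bar>\<rho>\<bar> * (norm (z - w) / norm z) + l * norm (z - w)"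
      if "f z $ k = Re (- c / z) + \<rho> * ln (norm z) + Re (Q z)"
        "f w $ k = Re (- c / w) + \<rho> * ln (norm w) + Re (Q w)"
        "\<And>x. x \<in> ball 0 s \<Longrightarrow> (Q has_field_derivative q x) (at x)"
        "\<And>x. x \<in> ball 0 s \<Longrightarrow> norm (q x) \<le> l" "z \<in> ball 0 s" "w \<in> ball 0 s"
      for k c \<rho> Q q s l
    proof -
      have "c * u = c / z - c / w"
        by (simp add: u_def right_diff_distrib)
      then have "Re (c * u) = Re (c / z) - Re (c / w)"
        by (simp only: minus_complex.sel)
      also have "\<dots> = \<rho> * (ln (norm z) - ln (norm w)) + Re (Q z - Q w)"
        using that(1,2) eq by (simp add: algebra_simps)
      finally have "Re (c * u) = \<rho> * (ln (norm z) - ln (norm w)) + Re (Q z - Q w)" .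
      then have "\<bar>Re (c * u)\<bar> \<le> \<bar>\<rho>\<bar> * \<bar>ln (norm z) - ln (norm w)\<bar> + norm (Q z - Q w)"
        using abs_triangle_ineq[of "\<rho> * (ln (norm z) - ln (norm w))" "Re (Q z - Q w)"]
          abs_Re_le_cmod[of "Q z - Q w"] by (simp add: abs_mult)
      \<comment> \<open>The segment from z to w may pass through 0, which is harmless because Q is
        differentiable on the full disk.\<close>
      also have "norm (Q z - Q w) \<le> l * norm (z - w)"
        by (rule field_differentiable_bound[of "ball 0 s" Q q])
          (use that(3-6) in \<open>auto intro: has_field_derivative_at_within\<close>)
      finally show ?thesis
        using mult_left_mono[OF ln, of "\<bar>\<rho>\<bar>"] by simp
    qed
    have "m * norm u \<le> \<bar>Re (c1 * u)\<bar> + \<bar>Re (c2 * u)\<bar>"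
      by (rule m)
    also have "\<dots> \<le> (\<bar>\<rho>1\<bar> * (norm (z - w) / norm z) + L1 * norm (z - w))
        + (\<bar>\<rho>2\<bar> * (norm (z - w) / norm z) + L2 * norm (z - w))"
      using z' w' by (intro add_mono bound[OF 1(8) 1(8) 1(5,6)] bound[OF 2(8) 2(8) 2(5,6)]) auto
    also have "\<dots> = (K + L * norm z) * (norm (z - w) / norm z)"
      using z(1) by (simp add: K_def L_def field_simps)
    also have "\<dots> \<le> (K + L) * (norm (z - w) / norm z)"
      using KL that(3) r by (intro mult_right_mono add_left_mono mult_left_le) auto
    \<comment> \<open>Substituted into the left side of the chain. Both sides then share the factor
      |z - w| / |z|, and cancelling it leaves m \<le> (K + L) * |w|, against
      \<open>small\<close>.\<close>
    also have "norm u = norm (z - w) / norm z / norm w"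
    proof -
      have "u = - ((z - w) / (z * w))"
        using z(1) w(1) by (simp add: u_def field_simps)
      then show ?thesis
        by (simp add: norm_divide norm_mult norm_minus_commute)
    qed
    finally have "m * (norm (z - w) / norm z / norm w) * norm w \<le> (K + L) * (norm (z - w) / norm z) * norm w"
      by (rule mult_right_mono) simp
    then have "m * (norm (z - w) / norm z) \<le> ((K + L) * norm w) * (norm (z - w) / norm z)"
      using w(1) by (simp add: mult_ac)
    then have "m \<le> (K + L) * norm w"
      by (rule mult_right_le_imp_le) (use that(1) z(1) in simp)
    then show False
      using small[of w] that(4) by simp
  qed
  have inj: "inj_on f (ball 0 r - {0})"
  proof (rule inj_onI, rule ccontr)
    fix z w assume "z \<in> ball 0 r - {0}" "w \<in> ball 0 r - {0}" "f z = f w" "z \<noteq> w"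
    then show False
      using no_double[of z w] no_double[of w z] by (cases "norm z \<le> norm w") auto
  qed

  define C where "C = (norm (Q1 0) + L1) + (norm (Q2 0) + L2)"
  have "filterlim (\<lambda>z::complex. (m / norm z + K * ln (norm z) - C) / 2) at_top (at 0)"
    by (rule filterlim_compose[OF log_perturbation_at_top[OF m(1)] filterlim_norm_at_right_0])
  \<comment> \<open>Apply \<open>m\<close> to u = 1 / z. Each of the two components is at most the
    norm of \<open>f z\<close>, whence the division by 2; C bounds the smooth terms.\<close>
  moreover have "eventually (\<lambda>z. (m / norm z + K * ln (norm z) - C) / 2 \<le> norm (f z)) (at 0)"
    unfolding eventually_at
  proof (intro exI conjI ballI impI)
    fix z :: complex assume "z \<noteq> 0 \<and> dist z 0 < r0"
    then have z: "z \<noteq> 0" "norm z < 1" "z \<in> ball 0 r0" "z \<in> ball 0 r0 - {0}"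
      using r0 by auto
    note z' = r0(3)[OF z(4)] r0(4)[OF z(3)]
    have bound: "\<bar>Re (c * (1 / z))\<bar> \<le> norm (f z) - \<bar>\<rho>\<bar> * ln (norm z) + (norm (Q 0) + l)"
      if "f z $ k = Re (- c / z) + \<rho> * ln (norm z) + Re (Q z)"
        "\<And>x. x \<in> ball 0 s \<Longrightarrow> (Q has_field_derivative q x) (at x)"
        "\<And>x. x \<in> ball 0 s \<Longrightarrow> norm (q x) \<le> l" "z \<in> ball 0 s"
      for k c \<rho> Q q s l
    proof -
      have s: "0 \<in> ball (0::complex) s"
        using that(4) by (auto intro: le_less_trans[OF norm_ge_zero])
      have l: "0 \<le> l"
        using order_trans[OF norm_ge_zero that(3)[OF s]] .
      have "norm (Q z - Q 0) \<le> l * norm (z - 0)"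
        by (rule field_differentiable_bound[of "ball 0 s" Q q])
          (use that(2-4) s in \<open>auto intro: has_field_derivative_at_within\<close>)
      also have "\<dots> \<le> l"
        using l z(2) by (simp add: mult_left_le)
      finally have "norm (Q z) \<le> norm (Q 0) + l"
        using norm_triangle_ineq2[of "Q z" "Q 0"] by simp
      moreover have "\<bar>Re (Q z)\<bar> \<le> norm (Q z)"
        by (rule abs_Re_le_cmod)
      moreover have "\<bar>f z $ k\<bar> \<le> norm (f z)"
        by (rule component_le_norm_cart)
      \<comment> \<open>The logarithm is negative because |z| < 1.\<close>
      moreover have "\<bar>\<rho> * ln (norm z)\<bar> = - \<bar>\<rho>\<bar> * ln (norm z)"
        using z by (simp add: abs_mult)
      moreover have "Re (c * (1 / z)) = \<rho> * ln (norm z) + Re (Q z) - f z $ k"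
        using that(1) by simp
      ultimately show ?thesis
        by linarith
    qed
    have "m * norm (1 / z) \<le> \<bar>Re (c1 * (1 / z))\<bar> + \<bar>Re (c2 * (1 / z))\<bar>"
      by (rule m)
    also have "\<dots> \<le> (norm (f z) - \<bar>\<rho>1\<bar> * ln (norm z) + (norm (Q1 0) + L1))
        + (norm (f z) - \<bar>\<rho>2\<bar> * ln (norm z) + (norm (Q2 0) + L2))"
      using z' by (intro add_mono bound[OF 1(8) 1(5,6)] bound[OF 2(8) 2(5,6)]) auto
    finally show "(m / norm z + K * ln (norm z) - C) / 2 \<le> norm (f z)"
      by (simp add: K_def C_def norm_divide algebra_simps)
  qed (use r0 in auto)
  ultimately have "filterlim (\<lambda>z. norm (f z)) at_top (at 0)"
    by (rule filterlim_at_top_mono)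
  then show ?thesis
    unfolding properly_embedded_def using r inj immersion by blast
qed

section \<open>Affine invariance and lexicographic minimality\<close>

lemma properly_embedded_affinely_equivalent:
  assumes "affinely_equivalent f h" and h: "properly_embedded h"
  shows "properly_embedded f"
proof -
  obtain M :: "real^3^3" and b where M: "invertible M" and hf: "\<And>z. z \<in> punctured_disk \<Longrightarrow> h z = M *v f z + b"
    using assms(1) unfolding affinely_equivalent_def by blast
  obtain M' where M': "M ** M' = mat 1" "M' ** M = mat 1"
    using M unfolding invertible_def by blast
  obtain K where K: "K > 0" "\<And>x. norm (M *v x) \<le> norm x * K"
    using bounded_linear.pos_bounded[OF matrix_vector_mul_bounded_linear[of M]] by blast
  obtain r where r: "0 < r" "r < 1" "inj_on h (ball 0 r - {0})" "immersion_on h (ball 0 r - {0})"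
    and lim: "filterlim (\<lambda>z. norm (h z)) at_top (at 0)"
    using h unfolding properly_embedded_def by blast
  have sub: "z \<in> punctured_disk" if "z \<in> ball 0 r - {0}" for z
    using that r by (auto simp: punctured_disk_def)
  have "filterlim (\<lambda>x. (x - norm b) / K) at_top at_top"
    using K(1) by real_asymp
  then have "filterlim (\<lambda>z. (norm (h z) - norm b) / K) at_top (at 0)"
    by (rule filterlim_compose) (rule lim)
  moreover have "eventually (\<lambda>z. (norm (h z) - norm b) / K \<le> norm (f z)) (at 0)"
    using eventually_punctured_disk
  proof eventually_elim
    case (elim z)
    have "norm (h z) \<le> norm (f z) * K + norm b"
      using norm_triangle_ineq[of "M *v f z" b] K(2)[of "f z"] hf[OF elim] by simp
    then show ?case
      using K(1) by (simp add: pos_divide_le_eq)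
  qed
  ultimately have "filterlim (\<lambda>z. norm (f z)) at_top (at 0)"
    by (rule filterlim_at_top_mono)
  moreover have "inj_on f (ball 0 r - {0})"
    using r(3) hf sub unfolding inj_on_def by metis
  moreover have "immersion_on f (ball 0 r - {0})"
    unfolding immersion_on_def
  proof
    fix z :: complex assume z: "z \<in> ball 0 r - {0}"
    obtain D where D: "(h has_derivative D) (at z)" "inj D"
      using r(4) z unfolding immersion_on_def by blast
    \<comment> \<open>Solving the affine relation for \<open>f\<close> transfers the derivative. The
      relation holds on the punctured disk only, so it is used on that open set.\<close>
    have "((\<lambda>w. M' *v (h w - b)) has_derivative (\<lambda>v. M' *v (D v - 0))) (at z)"
      by (rule bounded_linear.has_derivative[OF matrix_vector_mul_bounded_linear])
        (intro derivative_intros D)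
    moreover have "M' *v (h w - b) = f w" if "w \<in> punctured_disk" for w
      using hf[OF that] M'(2) by (simp add: matrix_vector_mul_assoc)
    ultimately have "(f has_derivative (\<lambda>v. M' *v (D v - 0))) (at z)"
      by (rule has_derivative_transform_within_open[OF _ open_punctured_disk sub[OF z]])
    then have "(f has_derivative (\<lambda>v. M' *v D v)) (at z)"
      by simp
    moreover have "inj (\<lambda>v. M' *v D v)"
    proof (rule injI)
      fix x y assume "M' *v D x = M' *v D y"
      then have "M *v (M' *v D x) = M *v (M' *v D y)"
        by simp
      then show "x = y"
        using D(2) M'(1) by (simp add: matrix_vector_mul_assoc inj_eq)
    qed
    ultimately show "\<exists>D. (f has_derivative D) (at z) \<and> inj D"
      by blast
  qed
  ultimately show ?thesis
    unfolding properly_embedded_def using r(1,2) by blast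
qed

text \<open>The competitor for minimality: subtracting t times the second coordinate from the first
  changes only the first form, and can lower its pole order when the leading terms cancel.\<close>

lemma end_of_forms_shear:
  fixes h :: "complex \<Rightarrow> real^3" and t :: real
  assumes h: "end_of_forms h \<omega>"
  defines "M \<equiv> vector [vector [1, - t, 0], vector [0, 1, 0], vector [0, 0, 1]] :: real^3^3"
    and "\<omega>' \<equiv> \<lambda>k. if k = 1 then (\<lambda>z. \<omega> 1 z - of_real t * \<omega> 2 z) else \<omega> k"
  shows "end_of_forms (\<lambda>z. M *v h z) \<omega>'" "affinely_equivalent h (\<lambda>z. M *v h z)"
proof -
  have comp: "(M *v x) $ 1 = x $ 1 - t * x $ 2" "(M *v x) $ 2 = x $ 2" "(M *v x) $ 3 = x $ 3" for x
    by (simp_all add: M_def matrix_vector_mult_def sum_3)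
  obtain z0 where z0: "z0 \<in> punctured_disk"
    using punctured_disk_def by (auto intro!: that[of "1/2"])
  have "meromorphic_forms \<omega>'"
    using end_of_forms_holomorphic[OF h] end_of_forms_meromorphic[OF h]
    by (auto simp: meromorphic_forms_def \<omega>'_def intro!: holomorphic_intros meromorphic_intros)
  moreover have "(M *v h (pathfinish \<gamma>)) $ k = (M *v h z0) $ k + Re (contour_integral \<gamma> (\<omega>' k))"
    if \<gamma>: "valid_path \<gamma>" "path_image \<gamma> \<subseteq> punctured_disk" "pathstart \<gamma> = z0" for \<gamma> k
  proof -
    have int: "\<omega> k contour_integrable_on \<gamma>" for k
      using contour_integrable_holomorphic_simple[OF end_of_forms_holomorphic[OF h] open_punctured_disk \<gamma>(1,2)] .
    have diff: "contour_integral \<gamma> (\<lambda>z. \<omega> 1 z - of_real t * \<omega> 2 z) =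
        contour_integral \<gamma> (\<omega> 1) - of_real t * contour_integral \<gamma> (\<omega> 2)"
      using int by (simp add: contour_integral_diff contour_integral_lmul contour_integrable_lmul)
    then show ?thesis
      using exhaust_3[of k] end_of_forms_increment[OF h \<gamma>(1,2)] \<gamma>(3)
      by (auto simp: comp \<omega>'_def diff distrib_left)
  qed
  ultimately show "end_of_forms (\<lambda>z. M *v h z) \<omega>'"
    unfolding end_of_forms_def using z0 by blast
  have "invertible M"
    by (simp add: invertible_det_nz det_3 M_def)
  then show "affinely_equivalent h (\<lambda>z. M *v h z)"
    unfolding affinely_equivalent_def by (intro exI[of _ M] exI[of _ 0]) simp
qed

theorem proposition2p13:
  fixes n :: int and f :: "complex \<Rightarrow> real^3"
  assumes "meromorphic_end f"
    and "has_end_type f (2, 2, n)"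
  shows "properly_embedded f"
proof -
  obtain h where fh: "affinely_equivalent f h" and red: "in_reduced_form h" and h: "has_pole_orders h (2, 2, n)"
    using assms(2) unfolding has_end_type_def by blast
  obtain \<omega> where \<omega>: "end_of_forms h \<omega>"
    and orders: "pole_order (\<omega> 1) = 2" "pole_order (\<omega> 2) = 2" "pole_order (\<omega> 3) = n"
    using h unfolding has_pole_orders_def by auto
  \<comment> \<open>By uniqueness of pole orders, the minimal triple of \<open>h\<close> is (2, 2,
    n) itself.\<close>
  have minimal: "(N, (2, 2, n)) \<notin> lex_less" if "affinely_equivalent h h'" "has_pole_orders h' N" for h' N
    using red that has_pole_orders_unique[OF h] unfolding in_reduced_form_def by metis
  have "pole_order (\<lambda>z. \<omega> 1 z - of_real t * \<omega> 2 z) \<ge> 2" for t :: real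
  proof (rule ccontr)
    assume less: "\<not> ?thesis"
    note shear = end_of_forms_shear[OF \<omega>, of t]
    \<comment> \<open>A first entry below 2 would already decide the lexicographic comparison.
      Minimality ranges over all equivalent ends, so the order of the three entries does not
      matter.\<close>
    have "((pole_order (\<lambda>z. \<omega> 1 z - of_real t * \<omega> 2 z), pole_order (\<omega> 2), pole_order (\<omega> 3)), (2, 2, n)) \<notin> lex_less"
      by (rule minimal[OF shear(2)]) (use shear(1) in \<open>force simp: has_pole_orders_def\<close>)
    then show False
      using less by (auto simp: lex_less_def)
  qed
  then have "properly_embedded h"
    by (rule double_pole_end_properly_embedded[OF \<omega> orders(1,2)])
  with fh show ?thesis
    by (rule properly_embedded_affinely_equivalent)
qed

end
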